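(* Let $f\in\mathcal{S}^*$ be given by $f(z)=z+\sum_{n=2}^{\infty}a_nz^n$ for $z\in\mathbb{D}$. Then $$|H_{2,1}(F_{f^{-1}}/2)|\le \frac{13}{12},$$ where $H_{2,1}(F_{f^{-1}}/2)=\Gamma_1\Gamma_3-\Gamma_2^2$ and $\Gamma_n$ are the logarithmic inverse coefficients of $f$. The inequality is sharp, that is, there exists $f\in\mathcal{S}^*$ for which equality holds.
   Context: Let $\mathbb{D}=\{z\in\mathbb{C}:|z|<1\}$. $\mathcal{A}$ denotes the class of analytic functions $f$ in $\mathbb{D}$ with $f(0)=0$ and $f'(0)=1$, and $\mathcal{S}\subset\mathcal{A}$ is the subclass of functions that are univalent (one-to-one) in $\mathbb{D}$. $\mathcal{S}^*$ is the class of starlike functions in $\mathcal{S}$, i.e. those $f\in\mathcal{S}$ for which $f(\mathbb{D})$ is starlike with respect to the origin (the line segment joining $0$ to any point of $f(\mathbb{D})$ lies entirely in $f(\mathbb{D})$); equivalently, a function $f\in\mathcal{A}$ is in $\mathcal{S}^*$ if and only if $\mathrm{Re}\left(\frac{zf'(z)}{f(z)}\right)>0$ for all $z\in\mathbb{D}$ (the quotient being given the value $1$ at $z=0$). For $f\in\mathcal{S}$, the inverse function $f^{-1}$ is defined and analytic in $|w|<1/4$ (by Koebe's $1/4$-theorem), with $f^{-1}(w)=w+\sum_{n=2}^\infty A_nw^n$. The logarithmic inverse coefficients $\Gamma_n$, $n\in\mathbb{N}$, of $f$ are defined by $$F_{f^{-1}}(w):=\log\frac{f^{-1}(w)}{w}=2\sum_{n=1}^{\infty}\Gamma_nw^n,\quad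 |w|<1/4,$$ where the branch of the logarithm is the analytic one with value $0$ at $w=0$. The second Hankel determinant of the logarithmic inverse coefficients is $H_{2,1}(F_{f^{-1}}/2):=\Gamma_1\Gamma_3-\Gamma_2^2$, which in terms of the coefficients of $f$ equals $\frac{1}{48}\left(13a_2^4-12a_2^2a_3-12a_3^2+12a_2a_4\right)$. *)

theory Defs
  imports "HOL-Complex_Analysis.Complex_Analysis"
begin

abbreviation unit_disc :: "complex set" where
  "unit_disc \<equiv> ball 0 1"

definition class_A :: "(complex \<Rightarrow> complex) set" where
  "class_A = {f. f holomorphic_on unit_disc \<and> f 0 = 0 \<and> deriv f 0 = 1}"

definition class_S :: "(complex \<Rightarrow> complex) set" where
  "class_S = {f \<in> class_A. inj_on f unit_disc}"

(* The library predicate "starlike" lets the centre of the set be arbitrary;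
   here it has to be the origin. *)
definition class_S_star :: "(complex \<Rightarrow> complex) set" where
  "class_S_star =
     {f \<in> class_S. \<forall>w \<in> f ` unit_disc. closed_segment 0 w \<subseteq> f ` unit_disc}"

(* log (f^{-1}(w) / w), with f^{-1} the inverse of the restriction of f to the disc
   and the removable singularity at w = 0 filled in.  The quotient tends to 1 as w
   tends to 0, so near 0 the principal logarithm is the analytic branch vanishing
   at w = 0.  Only this germ at 0 enters the coefficients below.  (For starlike f
   the two branches even agree on all of |w| < 1/4, since |arg (f(z)/z)| < pi.) *)
definition log_inverse :: "(complex \<Rightarrow> complex) \<Rightarrow> complex \<Rightarrow> complex" where
  "log_inverse f w = (if w = 0 then 0 else Ln (inv_into unit_disc f w / w))"

(* log_inverse f w = 2 * (\<Sum>n\<ge>1. log_inv_coeff f n * w ^ n) near w = 0 *)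
definition log_inv_coeff :: "(complex \<Rightarrow> complex) \<Rightarrow> nat \<Rightarrow> complex" where
  "log_inv_coeff f n = fps_nth (fps_expansion (log_inverse f) 0) n / 2"

definition hankel_2_1_log_inv :: "(complex \<Rightarrow> complex) \<Rightarrow> complex" where
  "hankel_2_1_log_inv f =
     log_inv_coeff f 1 * log_inv_coeff f 3 - (log_inv_coeff f 2)\<^sup>2"

end

theory Submission
  imports Defs
begin

text \<open>
  Since \<open>f\<close> is starlike, \<open>z \<mapsto> f\<^sup>-\<^sup>1 (t f(z))\<close> is, for \<open>0 \<le> t \<le> 1\<close>, a self-map of the disc
  fixing \<open>0\<close>. By the Schwarz lemma \<open>Re (z\<^sup>* f\<^sup>-\<^sup>1 (t f(z)))\<close>, with \<open>z\<^sup>*\<close> the conjugate of \<open>z\<close>, is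
  maximal at \<open>t = 1\<close>, and differentiating there gives \<open>Re (f(z) / (z f'(z))) \<ge> 0\<close>.
  Hence \<open>(z f' - f) / (z f' + f) = z \<phi>(z)\<close> with \<open>|\<phi>| \<le> 1\<close>. In terms of
  \<open>\<phi> = b\<^sub>0 + b\<^sub>1 z + b\<^sub>2 z\<^sup>2 + \<dots>\<close> the Hankel determinant is
  \<open>(13 b\<^sub>0\<^sup>4 - 10 b\<^sub>0\<^sup>2 b\<^sub>1 - 3 b\<^sub>1\<^sup>2 + 4 b\<^sub>0 b\<^sub>2) / 12\<close>, and the bounds
  \<open>|b\<^sub>1|, |b\<^sub>2| \<le> 1 - |b\<^sub>0|\<^sup>2\<close> already suffice. Equality holds for the Koebe function,
  for which \<open>\<phi> = 1\<close>.
\<close>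

subsection \<open>Coefficients of functions bounded by 1\<close>

lemma fps_eq_if_eventually_eq:
  fixes f g :: "complex \<Rightarrow> complex"
  assumes "f has_fps_expansion F" "g has_fps_expansion G" "\<forall>\<^sub>F z in nhds 0. f z = g z"
  shows "F = G"
  using assms fps_expansion_unique_complex has_fps_expansion_cong[of f g G G] by metis

text \<open>Limit \<open>r\<close> to 1 from the left. Estimates below are first proved after
  scaling or shrinking by \<open>r < 1\<close>, where strict bounds hold, and are then transferred
  by this lemma.\<close>

lemma le_of_power_mult_le:
  fixes a b c :: real
  assumes "\<And>r. 0 < r \<Longrightarrow> r < 1 \<Longrightarrow> r ^ n * a \<le> b - r ^ m * c"
  shows "a \<le> b - c"
proof (rule tendsto_le)
  show "((\<lambda>r::real. r ^ n * a) \<longlongrightarrow> a) (at_left 1)" "((\<lambda>r::real. b - r ^ m * c) \<longlongrightarrow> b - c) (at_left 1)"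
    by (auto intro!: tendsto_eq_intros)
  show "\<forall>\<^sub>F r in at_left 1. r ^ n * a \<le> b - r ^ m * c"
    by (rule eventually_mono[OF eventually_at_left_real[of 0 1]]) (use assms in auto)
qed auto

lemma norm_of_real_mult_less_1:
  fixes z :: complex
  assumes "0 < r" "r < 1" "norm z \<le> 1"
  shows "norm (of_real r * z) < 1"
  using mult_left_mono[of "norm z" 1 r] assms unfolding norm_mult norm_of_real by linarith

text \<open>The bound on \<open>\<omega>\<close> is not strict, so the Schwarz lemma is applied to
  \<open>r * \<omega>\<close>, which maps into the open disc, and then \<open>r\<close> tends to 1.
  At \<open>z = 0\<close> the quotient is the derivative, bounded by the same lemma.\<close>

lemma Schwarz_quotient:
  assumes hol: "\<omega> holomorphic_on ball 0 1" and "\<omega> 0 = 0"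
    and le: "\<And>z. norm z < 1 \<Longrightarrow> norm (\<omega> z) \<le> 1"
  obtains \<phi> where "\<phi> holomorphic_on ball 0 1" "\<And>z. norm z < 1 \<Longrightarrow> \<omega> z = z * \<phi> z"
    "\<And>z. norm z < 1 \<Longrightarrow> norm (\<phi> z) \<le> 1"
proof -
  obtain \<phi> where \<phi>: "\<phi> holomorphic_on ball 0 1" "\<And>z. norm z < 1 \<Longrightarrow> \<omega> z = z * \<phi> z" "deriv \<omega> 0 = \<phi> 0"
    using Schwarz3[OF hol \<open>\<omega> 0 = 0\<close>] by blast
  have "norm (\<phi> z) \<le> 1" if z: "norm z < 1" for z
  proof -
    have "r ^ 1 * norm (\<phi> z) \<le> 1 - r ^ 0 * 0" if r: "0 < r" "r < 1" for r :: real
    proof -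
      have holr: "(\<lambda>z. of_real r * \<omega> z) holomorphic_on ball 0 1"
        by (intro holomorphic_intros hol)
      have lt: "norm (of_real r * \<omega> z) < 1" if "norm z < 1" for z
        by (rule norm_of_real_mult_less_1[OF r le[OF that]])
      have d: "deriv (\<lambda>z. of_real r * \<omega> z) 0 = of_real r * deriv \<omega> 0"
        by (rule deriv_cmult) (use hol holomorphic_on_imp_differentiable_at in force)
      show ?thesis
      proof (cases "z = 0")
        case True
        with Schwarz_Lemma(2)[OF holr _ lt z] d \<phi>(3) \<open>\<omega> 0 = 0\<close> r show ?thesis
          by (simp add: norm_mult)
      next
        case False
        then show ?thesis
          using Schwarz_Lemma(1)[OF holr _ lt z] \<phi>(2)[OF z] \<open>\<omega> 0 = 0\<close> r
          by (simp add: norm_mult)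
      qed
    qed
    then show ?thesis using le_of_power_mult_le[of 1 "norm (\<phi> z)" 1 0 0] by simp
  qed
  with \<phi> that show thesis by blast
qed

text \<open>Cauchy's inequality on the circle of radius \<open>r < 1\<close>, so that no boundary
  behaviour of \<open>f\<close> matters; then \<open>r\<close> tends to 1.\<close>

lemma norm_fps_nth_le_1:
  assumes hol: "f holomorphic_on ball 0 1" and F: "f has_fps_expansion F"
    and le: "\<And>z. norm z < 1 \<Longrightarrow> norm (f z) \<le> 1"
  shows "norm (fps_nth F n) \<le> 1"
proof -
  have "r ^ n * norm (fps_nth F n) \<le> 1 - r ^ 0 * 0" if r: "0 < r" "r < 1" for r :: real
  proof -
    have "norm ((deriv ^^ n) f 0) \<le> fact n * 1 / r ^ n"
    proof (rule Cauchy_inequality)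
      show "f holomorphic_on ball 0 r" "continuous_on (cball 0 r) f"
        using r by (auto intro!: holomorphic_on_subset[OF hol]
            holomorphic_on_imp_continuous_on)
    qed (use r le in auto)
    then show ?thesis
      using r by (simp add: fps_nth_fps_expansion[OF F] norm_divide field_simps)
  qed
  then show ?thesis using le_of_power_mult_le[of n "norm (fps_nth F n)" 1 0 0] by simp
qed

text \<open>Moebius maps preserve the disc. Stated without a quotient, this stays meaningful when
  the denominator vanishes; the squares of the two sides differ by
  \<open>(1 - |a|^2) * (1 - |b|^2)\<close>.\<close>

lemma norm_diff_le_norm_one_minus:
  fixes a b :: complex
  assumes "norm a \<le> 1" "norm b \<le> 1"
  shows "norm (a - b) \<le> norm (1 - cnj b * a)"
proof -
  have "0 \<le> (1 - (norm a)\<^sup>2) * (1 - (norm b)\<^sup>2)"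
    using assms by (intro mult_nonneg_nonneg) (auto simp: power_le_one_iff)
  also have "\<dots> = (norm (1 - cnj b * a))\<^sup>2 - (norm (a - b))\<^sup>2"
    unfolding cmod_power2 by (simp add: power2_eq_square algebra_simps)
  finally show ?thesis by (simp add: power2_le_iff_abs_le)
qed

text \<open>Cauchy's estimate for \<open>f\<close> followed by the Moebius map sending \<open>f 0\<close> to \<open>0\<close>; scaling \<open>f\<close>
  by \<open>r < 1\<close> keeps that map finite when \<open>|f 0| = 1\<close>.\<close>
lemma norm_fps_nth_le_gap:
  assumes hol: "f holomorphic_on ball 0 1" and F: "f has_fps_expansion F"
    and le: "\<And>z. norm z < 1 \<Longrightarrow> norm (f z) \<le> 1"
    and n: "n > 0" and gap: "\<And>k. 0 < k \<Longrightarrow> k < n \<Longrightarrow> fps_nth F k = 0"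
  shows "norm (fps_nth F n) \<le> 1 - (norm (fps_nth F 0))\<^sup>2"
proof -
  define b where "b = fps_nth F 0"
  define S where "S = fps_shift n F"
  have F_eq: "F = fps_const b + fps_X ^ n * S"
    by (rule fps_ext) (use n gap in \<open>auto simp: S_def b_def fps_X_power_mult_nth\<close>)
  have f0: "f 0 = b"
    using has_fps_expansion_imp_0_eq_fps_nth_0[OF F] by (simp add: b_def)
  then have b1: "norm b \<le> 1" using le[of 0] by simp
  have "r ^ 1 * norm (fps_nth F n) \<le> 1 - r ^ 2 * (norm b)\<^sup>2" if r: "0 < r" "r < 1" for r :: real
  proof -
    define c where "c = of_real r * cnj (of_real r * b)"
    \<comment> \<open>\<open>H\<close> is the Moebius map w -> (w - rb) / (1 - cnj(rb) w) evaluated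
      at w = \<open>r * f z\<close>.\<close>
    define H where "H z = of_real r * (f z - b) / (1 - c * f z)" for z
    have rb: "norm (of_real r * b) < 1" and rf: "norm (of_real r * f z) < 1" if "norm z < 1" for z
      using norm_of_real_mult_less_1[OF r] b1 le[OF that] by auto
    have nz: "1 - c * f z \<noteq> 0" if "norm z < 1" for z
    proof -
      have "norm (c * f z) = norm (of_real r * b) * norm (of_real r * f z)"
        by (simp add: c_def norm_mult)
      also have "\<dots> < 1 * 1"
        by (intro mult_strict_mono' rb[OF that] rf[OF that]) auto
      finally show ?thesis by auto
    qed
    have "H holomorphic_on ball 0 1"
      unfolding H_def by (intro holomorphic_intros hol) (use nz in auto)
    moreover have "norm (H z) \<le> 1" if "norm z < 1" for z
    proof -
      have "norm (of_real r * f z - of_real r * b) \<le> norm (1 - cnj (of_real r * b) * (of_real r * f z))"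
        by (rule norm_diff_le_norm_one_minus) (use rb[OF that] rf[OF that] in auto)
      then show ?thesis
        using nz[OF that] by (simp add: H_def c_def norm_divide divide_le_eq algebra_simps)
    qed
    moreover obtain K where K: "H has_fps_expansion K"
      using calculation(1) has_fps_expansion_fps_expansion[of "ball 0 1" H] by auto
    ultimately have Kn: "norm (fps_nth K n) \<le> 1"
      using norm_fps_nth_le_1 by blast
    \<comment> \<open>Clearing the denominator allows coefficients to be compared without inverting
      a series.\<close>
    have "(\<lambda>z. H z * (1 - c * f z)) has_fps_expansion K * (1 - fps_const c * F)"
      "(\<lambda>z. of_real r * (f z - b)) has_fps_expansion fps_const (of_real r) * (F - fps_const b)"
      by (intro fps_expansion_intros K F)+
    moreover have "\<forall>\<^sub>F z in nhds 0. H z * (1 - c * f z) = of_real r * (f z - b)"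
      by (rule eventually_mono[OF eventually_nhds_in_open[of "ball 0 1"]]) (use nz in \<open>auto simp: H_def\<close>)
    ultimately have KF: "K * (1 - fps_const c * F) = fps_const (of_real r) * (F - fps_const b)"
      by (rule fps_eq_if_eventually_eq)
    have K0: "fps_nth K 0 = 0"
      using arg_cong[OF KF, of "\<lambda>P. fps_nth P 0"] nz[of 0] f0 by (auto simp: b_def)
    \<comment> \<open>Since \<open>K\<close> has no constant term, the last product starts at order
      \<open>n + 1\<close> and drops out of the \<open>n\<close>-th coefficient.\<close>
    have "K * (1 - fps_const c * F) = fps_const (1 - c * b) * K - fps_X ^ n * (fps_const c * (K * S))"
      unfolding F_eq by (simp add: algebra_simps flip: fps_const_mult fps_const_sub)
    then have "(1 - c * b) * fps_nth K n = of_real r * fps_nth F n"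
      using arg_cong[OF KF, of "\<lambda>P. fps_nth P n"] n K0 by (simp add: fps_X_power_mult_nth)
    moreover have "1 - c * b = of_real (1 - r\<^sup>2 * (norm b)\<^sup>2)"
      using complex_norm_square[of b] by (simp add: c_def power2_eq_square mult_ac)
    moreover have "r\<^sup>2 * (norm b)\<^sup>2 \<le> 1"
      using rb[of 0] r power_le_one[of "r * norm b" 2] by (simp add: norm_mult power_mult_distrib)
    ultimately have "r * norm (fps_nth F n) = (1 - r\<^sup>2 * (norm b)\<^sup>2) * norm (fps_nth K n)"
      using r by (metis abs_of_nonneg abs_of_pos diff_ge_0_iff_ge norm_mult norm_of_real)
    also have "\<dots> \<le> (1 - r\<^sup>2 * (norm b)\<^sup>2) * 1"
      using Kn \<open>r\<^sup>2 * (norm b)\<^sup>2 \<le> 1\<close> by (intro mult_left_mono) auto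
    finally show ?thesis by simp
  qed
  then show ?thesis
    using le_of_power_mult_le[of 1 "norm (fps_nth F n)" 1 2 "(norm b)\<^sup>2"] by (simp add: b_def)
qed

text \<open>The even part of \<open>f\<close> has no linear term.\<close>
lemma norm_fps_nth_2_le:
  assumes hol: "f holomorphic_on ball 0 1" and F: "f has_fps_expansion F"
    and le: "\<And>z. norm z < 1 \<Longrightarrow> norm (f z) \<le> 1"
  shows "norm (fps_nth F 2) \<le> 1 - (norm (fps_nth F 0))\<^sup>2"
proof -
  define E where "E = fps_const (1/2) * (F + (F oo - fps_X))"
  have En: "fps_nth E n = (if even n then fps_nth F n else 0)" for n
    by (simp add: E_def fps_compose_uminus' minus_one_power_iff)
  have "(\<lambda>z. 1/2 * (f z + (f \<circ> uminus) z)) has_fps_expansion E"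
    unfolding E_def by (intro fps_expansion_intros F) auto
  moreover have "(\<lambda>z. 1/2 * (f z + (f \<circ> uminus) z)) holomorphic_on ball 0 1"
    by (intro holomorphic_intros hol holomorphic_on_compose_gen[OF _ hol]) auto
  moreover have "norm (1/2 * (f z + (f \<circ> uminus) z)) \<le> 1" if "norm z < 1" for z
    using norm_triangle_ineq[of "f z" "f (-z)"] le[of z] le[of "-z"] that by (simp add: norm_mult)
  ultimately have "norm (fps_nth E 2) \<le> 1 - (norm (fps_nth E 0))\<^sup>2"
    by (intro norm_fps_nth_le_gap) (auto simp: En less_Suc_eq numeral_2_eq_2)
  then show ?thesis by (simp add: En)
qed

subsection \<open>The Schwarz function of a starlike function\<close>

lemma Re_mult_of_real: "Re (z * of_real x) = Re z * x"
  by simp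

text \<open>For nonzero \<open>z\<close> the expression is |z|^2 Re (f(z) / (z f'(z))); the factor
  \<open>cnj z\<close> avoids dividing by \<open>z\<close>.\<close>

lemma starlike_inverse:
  assumes "f \<in> class_S_star" "norm z < 1"
  shows "0 \<le> Re (cnj z * (f z / deriv f z))"
proof (rule ccontr)
  let ?D = "ball 0 1 :: complex set"
  assume neg: "\<not> ?thesis"
  from assms have hol: "f holomorphic_on ?D" and f0: "f 0 = 0" and inj: "inj_on f ?D"
    and star: "\<And>w. w \<in> f ` ?D \<Longrightarrow> closed_segment 0 w \<subseteq> f ` ?D"
    by (auto simp: class_S_star_def class_S_def class_A_def)
  obtain g where g: "g holomorphic_on f ` ?D" "\<And>z. z \<in> ?D \<Longrightarrow> deriv f z * deriv g (f z) = 1"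
      "\<And>z. z \<in> ?D \<Longrightarrow> g (f z) = z"
    using holomorphic_has_inverse[OF hol open_ball inj] by blast
  have opn: "open (f ` ?D)" by (rule open_mapping_thm3[OF hol open_ball inj])
  have z: "z \<in> ?D" using assms by simp
  have ray: "of_real t * f x \<in> f ` ?D" if "x \<in> ?D" "0 \<le> t" "t \<le> 1" for x t
  proof -
    have "of_real t * f x \<in> closed_segment 0 (f x)"
      unfolding in_segment using that by (auto simp: scaleR_conv_of_real)
    then show ?thesis using star[of "f x"] that by blast
  qed
  define u where "u t = Re (cnj z * g (of_real t * f z))" for t :: real
  have le: "u t \<le> u 1" if t: "0 \<le> t" "t \<le> 1" for t
  proof -
    \<comment> \<open>By starlikeness \<open>?h\<close> maps the disc into itself, and it fixes 0,
      so the Schwarz lemma gives |?h(z)| \<le> |z|.\<close>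
    let ?h = "\<lambda>x. g (of_real t * f x)"
    have "?h holomorphic_on ?D"
      by (rule holomorphic_on_compose_gen[OF _ g(1), unfolded o_def])
         (auto intro!: holomorphic_intros hol ray t)
    moreover have "?h 0 = 0" using g(3)[of 0] f0 by simp
    moreover have "norm (?h x) < 1" if x: "norm x < 1" for x
    proof -
      obtain y where "y \<in> ?D" "of_real t * f x = f y" using ray[of x t] t x by auto
      then show ?thesis using g(3)[of y] by simp
    qed
    ultimately have "norm (?h z) \<le> norm z"
      using Schwarz_Lemma(1)[of ?h z] z by simp
    then have "norm (cnj z * ?h z) \<le> (norm z)\<^sup>2"
      by (simp add: norm_mult power2_eq_square mult_left_mono)
    moreover have "u 1 = (norm z)\<^sup>2"
      unfolding cmod_power2 using g(3)[OF z] by (simp add: u_def power2_eq_square)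
    ultimately show ?thesis
      using complex_Re_le_cmod[of "cnj z * ?h z"] by (simp add: u_def)
  qed
  have dg: "deriv g (f z) = 1 / deriv f z" using inverse_unique[OF g(2)[OF z]] by (simp add: divide_inverse)
  have "(g has_field_derivative deriv g (f z)) (at (of_real 1 * f z))"
    using holomorphic_derivI[OF g(1) opn, of "f z"] z by simp
  moreover have "((\<lambda>t. of_real t * f z) has_vector_derivative f z) (at (1::real))"
    by (auto intro!: derivative_eq_intros)
  ultimately have "((g \<circ> (\<lambda>t. of_real t * f z)) has_vector_derivative f z * deriv g (f z)) (at (1::real))"
    by (intro field_vector_diff_chain_at)
  then have "(u has_field_derivative Re (cnj z * (f z * deriv g (f z)))) (at 1)"
    unfolding u_def o_def by (intro has_field_derivative_Re has_vector_derivative_mult_right)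
  moreover have "Re (cnj z * (f z * deriv g (f z))) < 0"
    using neg unfolding dg by simp
  \<comment> \<open>A negative derivative at 1 would make \<open>u\<close> exceed \<open>u 1\<close>
    just to the left of 1, contradicting \<open>le\<close>.\<close>
  ultimately obtain d where d: "d > 0" "\<And>h. 0 < h \<Longrightarrow> h < d \<Longrightarrow> u 1 < u (1 - h)"
    using DERIV_neg_dec_left by blast
  define h where "h = min (d / 2) 1"
  have h: "0 < h" "h < d" "h \<le> 1" using d(1) by (auto simp: h_def)
  then show False
    using d(2)[OF h(1,2)] le[of "1 - h"] by simp
qed

text \<open>\<open>\<omega>\<close> is the Cayley transform of z f'(z) / f(z), which has nonnegative
  real part. The product form is valid also at \<open>z = 0\<close>, where both sides vanish;
  writing f(z) = z u(z) cancels the common factor \<open>z\<close>.\<close>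

lemma starlike_Schwarz_function:
  assumes "f \<in> class_S_star"
  obtains \<omega> where "\<omega> holomorphic_on ball 0 1" "\<omega> 0 = 0" "\<And>z. norm z < 1 \<Longrightarrow> norm (\<omega> z) \<le> 1"
    "\<And>z. norm z < 1 \<Longrightarrow> \<omega> z * (z * deriv f z + f z) = z * deriv f z - f z"
proof -
  let ?D = "ball 0 1 :: complex set"
  from assms have hol: "f holomorphic_on ?D" and f0: "f 0 = 0" and df0: "deriv f 0 = 1"
    and inj: "inj_on f ?D"
    by (auto simp: class_S_star_def class_S_def class_A_def)
  obtain u where u: "u holomorphic_on ?D" "\<And>z. norm z < 1 \<Longrightarrow> f z = z * u z" "u 0 = 1"
    using Schwarz3[OF hol f0] df0 by metis
  have nz: "deriv f z \<noteq> 0" if "norm z < 1" for z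
    using holomorphic_injective_imp_regular[OF hol open_ball inj] that by simp
  have quot: "deriv f z + u z \<noteq> 0 \<and> norm (deriv f z - u z) \<le> norm (deriv f z + u z)"
    if z: "norm z < 1" for z
  proof (cases "z = 0")
    case True
    then show ?thesis using u(3) df0 by simp
  next
    case False
    have "0 \<le> Re (cnj z * (f z / deriv f z)) * (norm (deriv f z))\<^sup>2"
      using starlike_inverse[OF assms z] by simp
    also have "\<dots> = Re (cnj z * (f z / deriv f z) * of_real ((norm (deriv f z))\<^sup>2))"
      by (rule Re_mult_of_real[symmetric])
    also have "cnj z * (f z / deriv f z) * of_real ((norm (deriv f z))\<^sup>2) = u z * cnj (deriv f z) * of_real ((norm z)\<^sup>2)"
      using nz[OF z] u(2)[OF z] unfolding complex_norm_square by simp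
    also have "Re \<dots> = Re (u z * cnj (deriv f z)) * (norm z)\<^sup>2"
      by (rule Re_mult_of_real)
    finally have "0 \<le> Re (u z * cnj (deriv f z))"
      using False by (simp add: zero_le_mult_iff)
    \<comment> \<open>Polarization: nonnegativity of the real part is the same as |f' - u| \<le> |f'
      + u|.\<close>
    moreover have "(norm (deriv f z + u z))\<^sup>2 = (norm (deriv f z - u z))\<^sup>2 + 4 * Re (u z * cnj (deriv f z))"
      unfolding cmod_power2 by (simp add: power2_eq_square algebra_simps)
    ultimately have "norm (deriv f z - u z) \<le> norm (deriv f z + u z)"
      using norm_ge_zero[of "deriv f z + u z"] by (smt (verit) power2_le_imp_le)
    \<comment> \<open>If the sum vanished, the bound would make the difference vanish too, hence
      \<open>deriv f z = 0\<close>, which injectivity excludes.\<close>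
    moreover from this have "deriv f z + u z \<noteq> 0"
      using nz[OF z] by (auto simp: add_eq_0_iff)
    ultimately show ?thesis by simp
  qed
  show thesis
  proof (rule that[of "\<lambda>z. (deriv f z - u z) / (deriv f z + u z)"])
    show "(\<lambda>z. (deriv f z - u z) / (deriv f z + u z)) holomorphic_on ?D"
      using quot by (intro holomorphic_intros hol u) auto
    show "(deriv f 0 - u 0) / (deriv f 0 + u 0) = 0" using u(3) df0 by simp
    show "norm ((deriv f z - u z) / (deriv f z + u z)) \<le> 1" if "norm z < 1" for z
      using quot[OF that] by (simp add: norm_divide)
    show "(deriv f z - u z) / (deriv f z + u z) * (z * deriv f z + f z) = z * deriv f z - f z"
      if "norm z < 1" for z
    proof -
      have "z * deriv f z + f z = z * (deriv f z + u z)" "z * deriv f z - f z = z * (deriv f z - u z)"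
        using u(2)[OF that] by (simp_all add: algebra_simps)
      then show ?thesis using quot[OF that] by simp
    qed
  qed
qed

subsection \<open>The Hankel determinant in terms of Taylor coefficients\<close>

text \<open>With L = \<open>log_inverse f\<close> the inverse function is w exp(L(w)), so F composed
  with X exp(L) is X. Comparing coefficients up to order 4 determines the first three coefficients
  of L.\<close>

lemma hankel_2_1_log_inv_eq:
  assumes "f \<in> class_S" and F: "f has_fps_expansion F"
  defines "a \<equiv> fps_nth F"
  shows "hankel_2_1_log_inv f =
    (13 * a 2 ^ 4 - 12 * (a 2)\<^sup>2 * a 3 - 12 * (a 3)\<^sup>2 + 12 * a 2 * a 4) / 48"
proof -
  let ?D = "ball 0 1 :: complex set"
  from assms have hol: "f holomorphic_on ?D" and f0: "f 0 = 0" and df0: "deriv f 0 = 1"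
    and inj: "inj_on f ?D"
    by (auto simp: class_S_def class_A_def)
  have a01: "a 0 = 0" "a 1 = 1"
    using f0 df0 by (simp_all add: a_def fps_nth_fps_expansion[OF F])
  define g where "g = inv_into ?D f"
  obtain g' where g': "g' holomorphic_on f ` ?D" "\<And>z. z \<in> ?D \<Longrightarrow> deriv f z * deriv g' (f z) = 1"
      "\<And>z. z \<in> ?D \<Longrightarrow> g' (f z) = z"
    using holomorphic_has_inverse[OF hol open_ball inj] by blast
  have opn: "open (f ` ?D)" by (rule open_mapping_thm3[OF hol open_ball inj])
  have gg': "g w = g' w" if "w \<in> f ` ?D" for w
    using that g'(3) inj by (auto simp: g_def)
  have "g holomorphic_on f ` ?D"
    using g'(1) gg' by (simp cong: holomorphic_cong)
  moreover have zero: "0 \<in> f ` ?D" using f0 by (metis centre_in_ball imageI zero_less_one)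
  moreover obtain r where r: "r > 0" "ball 0 r \<subseteq> f ` ?D"
    using opn zero open_contains_ball by blast
  ultimately have holg: "g holomorphic_on ball 0 r"
    using holomorphic_on_subset by blast
  have g0: "g 0 = 0" using gg'[OF zero] g'(3)[of 0] f0 by simp
  have "deriv g 0 = deriv g' 0"
    using gg' eventually_nhds_in_open[OF opn zero]
    by (intro deriv_cong_ev) (auto elim!: eventually_mono)
  then have "deriv g 0 = 1" using g'(2)[of 0] f0 df0 by simp
  then obtain h where h: "h holomorphic_on ball 0 r" "\<And>w. norm w < r \<Longrightarrow> g w = w * h w" "h 0 = 1"
    using Schwarz3[OF holg g0] by metis
  define L where "L = log_inverse f"
  \<comment> \<open>At \<open>w = 0\<close> the default value 0 of \<open>log_inverse\<close> agrees
    with \<open>Ln (h 0) = Ln 1\<close>, so \<open>L\<close> is analytic there.\<close>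
  have Lh: "L w = Ln (h w)" if "norm w < r" for w
    using h(2)[OF that] h(3) by (auto simp: L_def log_inverse_def g_def)
  have "(\<lambda>w. Ln (h w)) analytic_on {0}"
  proof (rule analytic_on_compose_gen[of h _ Ln "- \<real>\<^sub>\<le>\<^sub>0", unfolded o_def])
    show "h analytic_on {0}"
      using h(1) r analytic_on_open[of "ball 0 r" h] analytic_on_subset[of h "ball 0 r" "{0}"] by auto
    show "Ln analytic_on - \<real>\<^sub>\<le>\<^sub>0"
      by (subst analytic_on_open) (auto intro!: holomorphic_intros closed_nonpos_Reals_complex)
  qed (use h(3) in auto)
  moreover have ev: "\<forall>\<^sub>F w in nhds (0::complex). norm w < r"
    using eventually_nhds_in_open[of "ball 0 r" "0::complex"] r by simp
  ultimately have "L analytic_on {0}"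
    using Lh by (subst analytic_at_cong[where g = "\<lambda>w. Ln (h w)"]) (auto elim: eventually_mono)
  then have exL: "L has_fps_expansion fps_expansion L 0"
    by (rule analytic_at_imp_has_fps_expansion_0)
  \<comment> \<open>\<open>l n\<close> is twice the logarithmic inverse coefficient.\<close>
  define l where "l = fps_nth (fps_expansion L 0)"
  define E where "E = fps_exp 1 oo fps_expansion L 0"
  have l0: "l 0 = 0"
    by (simp add: l_def fps_expansion_def L_def log_inverse_def)
  define G where "G = fps_X * E"
  have "(\<lambda>w. w * (exp \<circ> L) w) has_fps_expansion G"
    unfolding G_def E_def
    by (intro fps_expansion_intros exL) (use l0 in \<open>simp add: l_def\<close>)
  then have "(f \<circ> (\<lambda>w. w * (exp \<circ> L) w)) has_fps_expansion (F oo G)"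
    by (intro has_fps_expansion_compose F) (simp_all add: G_def)
  moreover have "(f \<circ> (\<lambda>w. w * (exp \<circ> L) w)) w = w" if "norm w < r" for w
  proof -
    have w: "w \<in> f ` ?D" using r that by auto
    then have fg: "f (g w) = w" by (simp add: g_def f_inv_into_f)
    \<comment> \<open>Needed for \<open>exp (Ln (h w)) = h w\<close>.\<close>
    have "h w \<noteq> 0"
    proof
      assume 0: "h w = 0"
      then have "g w = 0" using h(2)[OF that] by simp
      then have "w = 0" using fg f0 by simp
      then show False using 0 h(3) by simp
    qed
    then show ?thesis using fg Lh[OF that] h(2)[OF that] by simp
  qed
  then have "\<forall>\<^sub>F w in nhds 0. (f \<circ> (\<lambda>w. w * (exp \<circ> L) w)) w = w"
    using ev by (auto elim: eventually_mono)
  ultimately have FG: "F oo G = fps_X"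
    by (intro fps_eq_if_eventually_eq[OF _ has_fps_expansion_fps_X])
  have E: "fps_nth E 0 = 1" "fps_nth E 1 = l 1" "fps_nth E 2 = l 2 + (l 1)\<^sup>2 / 2"
    "fps_nth E 3 = l 3 + l 1 * l 2 + l 1 ^ 3 / 6"
    using l0 unfolding E_def fps_compose_nth l_def
    by (simp_all add: eval_nat_numeral fps_mult_nth field_simps)
  have G: "fps_nth G 0 = 0" "fps_nth G 1 = 1" "fps_nth G 2 = l 1" "fps_nth G 3 = l 2 + (l 1)\<^sup>2 / 2"
    "fps_nth G 4 = l 3 + l 1 * l 2 + l 1 ^ 3 / 6"
    using E by (simp_all add: G_def)
  have "fps_nth (F oo G) 2 = a 1 * fps_nth G 2 + a 2"
    "fps_nth (F oo G) 3 = a 1 * fps_nth G 3 + a 2 * (2 * fps_nth G 2) + a 3"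
    "fps_nth (F oo G) 4 = a 1 * fps_nth G 4 + a 2 * (2 * fps_nth G 3 + (fps_nth G 2)\<^sup>2)
       + a 3 * (3 * fps_nth G 2) + a 4"
    using G(1,2) a01 unfolding fps_compose_nth a_def
    by (simp_all add: eval_nat_numeral fps_mult_nth algebra_simps)
  then have "l 1 = - a 2" "l 2 + (l 1)\<^sup>2 / 2 = - (a 2 * (2 * l 1) + a 3)"
    "l 3 + l 1 * l 2 + l 1 ^ 3 / 6 =
      - (a 2 * (2 * (l 2 + (l 1)\<^sup>2 / 2) + (l 1)\<^sup>2) + a 3 * (3 * l 1) + a 4)"
    unfolding FG G using a01 by (simp_all add: add_eq_0_iff)
  note eqs = this
  have l1: "l 1 = - a 2" by (fact eqs(1))
  have l2: "l 2 = 3/2 * (a 2)\<^sup>2 - a 3"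
    using eqs(2) unfolding l1 by (simp add: field_simps power2_eq_square)
  have l3: "l 3 = - 10/3 * a 2 ^ 3 + 4 * a 2 * a 3 - a 4"
  proof -
    have "l 3 = (l 3 + l 1 * l 2 + l 1 ^ 3 / 6) - l 1 * l 2 - l 1 ^ 3 / 6" by simp
    also have "\<dots> = - 10/3 * a 2 ^ 3 + 4 * a 2 * a 3 - a 4"
      unfolding eqs(3) unfolding l1 l2 by (simp add: field_simps power2_eq_square power3_eq_cube)
    finally show ?thesis .
  qed
  show ?thesis
    unfolding hankel_2_1_log_inv_def log_inv_coeff_def L_def[symmetric] l_def[symmetric] l1 l2 l3
    by (simp add: field_simps eval_nat_numeral)
qed

subsection \<open>The upper bound\<close>

text \<open>The triangle inequality leaves a polynomial in x = |b0| on [0,1], which attains 13 at x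
  = 1.\<close>

lemma norm_hankel_Schwarz_le:
  fixes b0 b1 b2 :: complex
  assumes b1: "norm b1 \<le> 1 - (norm b0)\<^sup>2" and b2: "norm b2 \<le> 1 - (norm b0)\<^sup>2"
  shows "norm (13 * b0 ^ 4 - 10 * b0\<^sup>2 * b1 - 3 * b1\<^sup>2 + 4 * b0 * b2) \<le> 13"
proof -
  define x where "x = norm b0"
  have "x\<^sup>2 \<le> 1" using b1 norm_ge_zero[of b1] unfolding x_def by linarith
  then have x: "0 \<le> x" "x \<le> 1" using abs_square_le_1[of x] by (auto simp: x_def)
  have "norm (13 * b0 ^ 4 - 10 * b0\<^sup>2 * b1 - 3 * b1\<^sup>2 + 4 * b0 * b2)
      \<le> norm (13 * b0 ^ 4) + norm (10 * b0\<^sup>2 * b1) + norm (3 * b1\<^sup>2) + norm (4 * b0 * b2)"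
    by (intro order_trans[OF norm_triangle_ineq] order_trans[OF norm_triangle_ineq4] add_mono order_refl)
  also have "\<dots> = 13 * x ^ 4 + 10 * x\<^sup>2 * norm b1 + 3 * (norm b1)\<^sup>2 + 4 * x * norm b2"
    by (simp add: norm_mult norm_power x_def)
  also have "\<dots> \<le> 13 * x ^ 4 + 10 * x\<^sup>2 * (1 - x\<^sup>2) + 3 * (1 - x\<^sup>2)\<^sup>2 + 4 * x * (1 - x\<^sup>2)"
    using b1 b2 x unfolding x_def by (intro add_mono mult_left_mono power_mono order_refl) auto
  \<comment> \<open>The root \<open>x = 1\<close> of the gap is split off; the cofactor has only
    positive coefficients.\<close>
  also have "\<dots> = 13 - (1 - x) * (10 + 6 * x + 2 * x\<^sup>2 + 6 * x ^ 3)"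
    by (simp add: algebra_simps eval_nat_numeral)
  also have "\<dots> \<le> 13"
    using x by simp
  finally show ?thesis .
qed

lemma norm_hankel_2_1_log_inv_le:
  assumes f: "f \<in> class_S_star"
  shows "norm (hankel_2_1_log_inv f) \<le> 13 / 12"
proof -
  have fS: "f \<in> class_S" and hol: "f holomorphic_on ball 0 1" and f0: "f 0 = 0" and df0: "deriv f 0 = 1"
    using f by (auto simp: class_S_star_def class_S_def class_A_def)
  obtain F where F: "f has_fps_expansion F"
    using has_fps_expansion_fps_expansion[OF open_ball _ hol] by auto
  define a where "a = fps_nth F"
  have a01: "a 0 = 0" "a 1 = 1"
    using f0 df0 by (simp_all add: a_def fps_nth_fps_expansion[OF F])
  obtain \<omega> where \<omega>: "\<omega> holomorphic_on ball 0 1" "\<omega> 0 = 0" "\<And>z. norm z < 1 \<Longrightarrow> norm (\<omega> z) \<le> 1"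
    "\<And>z. norm z < 1 \<Longrightarrow> \<omega> z * (z * deriv f z + f z) = z * deriv f z - f z"
    using starlike_Schwarz_function[OF f] by blast
  obtain \<phi> where \<phi>: "\<phi> holomorphic_on ball 0 1" "\<And>z. norm z < 1 \<Longrightarrow> \<omega> z = z * \<phi> z"
    "\<And>z. norm z < 1 \<Longrightarrow> norm (\<phi> z) \<le> 1"
    using Schwarz_quotient[OF \<omega>(1-3)] by blast
  obtain P where P: "\<phi> has_fps_expansion P"
    using has_fps_expansion_fps_expansion[OF open_ball _ \<phi>(1)] by auto
  define b where "b = fps_nth P"
  have "norm (b 1) \<le> 1 - (norm (b 0))\<^sup>2" "norm (b 2) \<le> 1 - (norm (b 0))\<^sup>2"
    unfolding b_def using norm_fps_nth_le_gap[OF \<phi>(1) P \<phi>(3), of 1] norm_fps_nth_2_le[OF \<phi>(1) P \<phi>(3)]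
    by auto
  note bound = norm_hankel_Schwarz_le[OF this]
  have "(\<lambda>z. z * \<phi> z * (z * deriv f z + f z)) has_fps_expansion fps_X * P * (fps_X * fps_deriv F + F)"
    "(\<lambda>z. z * deriv f z - f z) has_fps_expansion fps_X * fps_deriv F - F"
    by (intro fps_expansion_intros P F)+
  moreover have "\<forall>\<^sub>F z in nhds 0. z * \<phi> z * (z * deriv f z + f z) = z * deriv f z - f z"
    by (rule eventually_mono[OF eventually_nhds_in_open[of "ball 0 1"]]) (use \<omega>(4) \<phi>(2) in auto)
  ultimately have eq: "fps_X * P * (fps_X * fps_deriv F + F) = fps_X * fps_deriv F - F"
    by (rule fps_eq_if_eventually_eq)
  have coeffs: "fps_nth (fps_X * (P * (fps_X * fps_deriv F + F))) n = fps_nth (fps_X * fps_deriv F - F) n" for n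
    using eq by (simp add: mult.assoc)
  \<comment> \<open>Orders 0 and 1 of the identity are trivial; orders 2, 3, 4 successively yield
    \<open>a 2\<close>, \<open>a 3\<close>, \<open>a 4\<close>.\<close>
  have "2 * b 0 = a 2" "2 * b 1 + 3 * a 2 * b 0 = 2 * a 3" "2 * b 2 + 3 * a 2 * b 1 + 4 * a 3 * b 0 = 3 * a 4"
    using coeffs[of 2] coeffs[of 3] coeffs[of 4] a01 unfolding a_def b_def
    by (simp_all add: eval_nat_numeral fps_mult_nth algebra_simps)
  note eqs = this
  have a2: "a 2 = 2 * b 0" using eqs(1) by simp
  have "a 3 = (2 * a 3) / 2" by simp
  also have "\<dots> = b 1 + 3 * (b 0)\<^sup>2"
    unfolding eqs(2)[symmetric] a2 by (simp add: field_simps power2_eq_square)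
  finally have a3: "a 3 = b 1 + 3 * (b 0)\<^sup>2" .
  have "a 4 = (3 * a 4) / 3" by simp
  also have "\<dots> = 2/3 * b 2 + 10/3 * b 0 * b 1 + 4 * b 0 ^ 3"
    unfolding eqs(3)[symmetric] a2 a3 by (simp add: field_simps power2_eq_square power3_eq_cube)
  finally have a4: "a 4 = 2/3 * b 2 + 10/3 * b 0 * b 1 + 4 * b 0 ^ 3" .
  have "hankel_2_1_log_inv f =
      (13 * a 2 ^ 4 - 12 * (a 2)\<^sup>2 * a 3 - 12 * (a 3)\<^sup>2 + 12 * a 2 * a 4) / 48"
    unfolding a_def by (rule hankel_2_1_log_inv_eq[OF fS F])
  also have "\<dots> = (13 * b 0 ^ 4 - 10 * (b 0)\<^sup>2 * b 1 - 3 * (b 1)\<^sup>2 + 4 * b 0 * b 2) / 12"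
    unfolding a2 a3 a4 by (simp add: field_simps eval_nat_numeral)
  finally have hankel: "hankel_2_1_log_inv f = \<dots>" .
  show ?thesis unfolding hankel norm_divide using bound by simp
qed

subsection \<open>The Koebe function\<close>

definition koebe :: "complex \<Rightarrow> complex" where
  "koebe z = z / (1 - z)\<^sup>2"

text \<open>Up to an affine map, \<open>koebe\<close> is the Cayley map onto the right half-plane
  followed by squaring. Injectivity and the image are both read off from this.\<close>

lemma koebe_eq_Cayley:
  assumes "z \<noteq> 1"
  shows "4 * koebe z + 1 = ((1 + z) / (1 - z))\<^sup>2"
  using assms by (simp add: koebe_def divide_simps power2_eq_square) (simp add: algebra_simps)

lemma Re_Cayley_pos:
  assumes "norm z < 1"
  shows "Re ((1 + z) / (1 - z)) > 0"
proof -
  have "Re ((1 + z) * cnj (1 - z)) = 1 - (norm z)\<^sup>2"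
    unfolding cmod_power2 by (simp add: power2_eq_square algebra_simps)
  also have "\<dots> > 0" using assms by (simp add: power_less_one_iff)
  finally show ?thesis
    by (simp only: Re_complex_div_gt_0)
qed

lemma inj_on_koebe: "inj_on koebe (ball 0 1)"
proof (rule inj_onI)
  fix z w :: complex
  assume "z \<in> ball 0 1" "w \<in> ball 0 1" and eq: "koebe z = koebe w"
  then have z: "norm z < 1" "z \<noteq> 1" and w: "norm w < 1" "w \<noteq> 1" by auto
  from eq have "((1 + z) / (1 - z))\<^sup>2 = ((1 + w) / (1 - w))\<^sup>2"
    using koebe_eq_Cayley z w by metis
  \<comment> \<open>The other root, with opposite sign, would lie in the left half-plane.\<close>
  then have "(1 + z) / (1 - z) = (1 + w) / (1 - w)"
    using Re_Cayley_pos[OF z(1)] Re_Cayley_pos[OF w(1)] by (auto simp: power2_eq_iff)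
  then show "z = w" using z w by (simp add: frac_eq_eq) (simp add: algebra_simps)
qed

text \<open>Squaring maps the right half-plane onto the plane slit along the nonpositive reals;
  hence \<open>koebe\<close> omits exactly the ray from -1/4 to the left.\<close>

lemma koebe_image: "koebe ` ball 0 1 = {w. 4 * w + 1 \<notin> \<real>\<^sub>\<le>\<^sub>0}"
proof (intro equalityI subsetI)
  fix w assume "w \<in> koebe ` ball 0 1"
  then obtain z where z: "norm z < 1" "w = koebe z" by auto
  then have "z \<noteq> 1" by auto
  define s where "s = (1 + z) / (1 - z)"
  have "Re s > 0" using Re_Cayley_pos[OF z(1)] by (simp add: s_def)
  then have "s\<^sup>2 \<notin> \<real>\<^sub>\<le>\<^sub>0"
    by (auto simp: complex_nonpos_Reals_iff power2_eq_square mult_le_0_iff)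
  then show "w \<in> {w. 4 * w + 1 \<notin> \<real>\<^sub>\<le>\<^sub>0}"
    using koebe_eq_Cayley[OF \<open>z \<noteq> 1\<close>] by (simp add: s_def z(2))
next
  fix w :: complex
  assume w: "w \<in> {w. 4 * w + 1 \<notin> \<real>\<^sub>\<le>\<^sub>0}"
  define s where "s = csqrt (4 * w + 1)"
  have s2: "s\<^sup>2 = 4 * w + 1" by (simp add: s_def)
  have s0: "Re s > 0"
  proof (rule ccontr)
    assume "\<not> Re s > 0"
    \<comment> \<open>The principal root has nonnegative real part; a purely imaginary root would
      put its square on the slit.\<close>
    then have "Re s = 0" using csqrt_principal[of "4 * w + 1"] by (auto simp: s_def)
    then have "s\<^sup>2 \<in> \<real>\<^sub>\<le>\<^sub>0" by (simp add: complex_nonpos_Reals_iff power2_eq_square)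
    with w s2 show False by simp
  qed
  then have s1: "s + 1 \<noteq> 0" by (auto simp: complex_eq_iff)
  \<comment> \<open>The inverse Cayley transform of \<open>s\<close>.\<close>
  define z where "z = (s - 1) / (s + 1)"
  have "(norm (s - 1))\<^sup>2 < (norm (s + 1))\<^sup>2"
    unfolding cmod_power2 using s0 by (simp add: power2_eq_square algebra_simps)
  then have z: "norm z < 1"
    using s1 by (simp add: z_def norm_divide power2_less_imp_less)
  then have "z \<noteq> 1" by auto
  have "(1 + z) / (1 - z) = s" using s1 by (simp add: z_def divide_simps)
  then have "w = koebe z" using koebe_eq_Cayley[OF \<open>z \<noteq> 1\<close>] s2 by simp
  then show "w \<in> koebe ` ball 0 1" using z by auto
qed

lemma koebe_has_fps_expansion: "koebe has_fps_expansion fps_X * inverse ((1 - fps_X)\<^sup>2)"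
proof -
  have "(\<lambda>z::complex. z * inverse ((1 - z)\<^sup>2)) has_fps_expansion fps_X * inverse ((1 - fps_X)\<^sup>2)"
    by (intro fps_expansion_intros) simp
  then show ?thesis unfolding koebe_def divide_inverse .
qed

lemma koebe_fps_nth: "fps_nth (fps_X * inverse ((1 - fps_X)\<^sup>2 :: complex fps)) n = of_nat n"
  by (cases n) (simp_all add: fps_one_over_one_minus_fps_X_squared)

lemma koebe_class_S_star: "koebe \<in> class_S_star"
proof -
  have "koebe holomorphic_on ball 0 1"
    unfolding koebe_def by (intro holomorphic_intros) auto
  moreover have "koebe 0 = 0" by (simp add: koebe_def)
  moreover have "deriv koebe 0 = 1"
    using fps_nth_fps_expansion[OF koebe_has_fps_expansion, of 1] unfolding koebe_fps_nth by simp
  moreover have "closed_segment 0 w \<subseteq> koebe ` ball 0 1" if "w \<in> koebe ` ball 0 1" for w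
  proof
    fix v assume "v \<in> closed_segment 0 w"
    then obtain t where t: "0 \<le> t" "t \<le> 1" "v = of_real t * w"
      by (auto simp: in_segment scaleR_conv_of_real)
    \<comment> \<open>Contrapositive: if \<open>v\<close>, which is \<open>t * w\<close>, lies on
      the omitted ray, then \<open>w\<close> lies there too, being further from 0 on the same
      ray.\<close>
    have "4 * w + 1 \<in> \<real>\<^sub>\<le>\<^sub>0" if v: "4 * v + 1 \<in> \<real>\<^sub>\<le>\<^sub>0"
    proof -
      have *: "t * (4 * Re w) + 1 \<le> 0" "t * Im w = 0" 
        using v t by (auto simp: complex_nonpos_Reals_iff algebra_simps)
      then have "t \<noteq> 0" by auto
      then have "Re w < 0" using * t by (smt (verit) mult_nonneg_nonneg)
      then have "4 * Re w \<le> t * (4 * Re w)" using t by (simp add: mult_le_cancel_right1)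
      then show ?thesis using * \<open>t \<noteq> 0\<close> by (simp add: complex_nonpos_Reals_iff)
    qed
    then show "v \<in> koebe ` ball 0 1"
      using \<open>w \<in> koebe ` ball 0 1\<close> unfolding koebe_image by blast
  qed
  ultimately show ?thesis
    using inj_on_koebe by (simp add: class_S_star_def class_S_def class_A_def)
qed

lemma hankel_2_1_log_inv_koebe: "hankel_2_1_log_inv koebe = 13 / 12"
proof -
  have "koebe \<in> class_S" using koebe_class_S_star by (simp add: class_S_star_def)
  from hankel_2_1_log_inv_eq[OF this koebe_has_fps_expansion]
  show ?thesis unfolding koebe_fps_nth by simp
qed

theorem theorem3p2:
  shows "(\<forall>f \<in> class_S_star. norm (hankel_2_1_log_inv f) \<le> 13 / 12) \<and>
         (\<exists>f \<in> class_S_star. norm (hankel_2_1_log_inv f) = 13 / 12)"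
proof (intro conjI ballI bexI[of _ koebe])
  show "norm (hankel_2_1_log_inv f) \<le> 13 / 12" if "f \<in> class_S_star" for f
    by (rule norm_hankel_2_1_log_inv_le[OF that])
  show "norm (hankel_2_1_log_inv koebe) = 13 / 12"
    unfolding hankel_2_1_log_inv_koebe by simp
qed (rule koebe_class_S_star)

end
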